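(* Let $n,k,c$ be positive integers with $n=ck+r$, where $0\le r<k$. Then $$SP(n,k)\le \frac{\binom nc}{(k-r)+\frac{r(c+1)}{n-c}},$$ where the term $\frac{r(c+1)}{n-c}$ is $0$ when $r=0$.
   Context: $\mathcal{P}^n_k$ is the set of all $k$-partitions of $\{1,\dots,n\}$, i.e. partitions into exactly $k$ non-empty classes. Two partitions $P=\{P_1,\dots,P_k\}$ and $Q=\{Q_1,\dots,Q_k\}$ in $\mathcal{P}^n_k$ have the Sperner property if $P_i\not\subseteq Q_j$ and $Q_i\not\subseteq P_j$ for all $i,j\in\{1,\dots,k\}$. A set $\mathcal{P}\subseteq\mathcal{P}^n_k$ is a Sperner partition system if all distinct $P,Q\in\mathcal{P}$ have the Sperner property. $SP(n,k)$ is the maximum cardinality of a Sperner partition system in $\mathcal{P}^n_k$. *)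

theory Defs
  imports Complex_Main "HOL-Library.Disjoint_Sets"
begin

definition k_partitions :: "nat \<Rightarrow> nat \<Rightarrow> nat set set set" where
  "k_partitions n k = {P. partition_on {1..n} P \<and> card P = k}"

definition sperner_property :: "'a set set \<Rightarrow> 'a set set \<Rightarrow> bool" where
  "sperner_property P Q \<longleftrightarrow> (\<forall>A\<in>P. \<forall>B\<in>Q. \<not> A \<subseteq> B \<and> \<not> B \<subseteq> A)"

definition sperner_partition_system :: "nat \<Rightarrow> nat \<Rightarrow> nat set set set \<Rightarrow> bool" where
  "sperner_partition_system n k S \<longleftrightarrow>
     S \<subseteq> k_partitions n k \<and> (\<forall>P\<in>S. \<forall>Q\<in>S. P \<noteq> Q \<longrightarrow> sperner_property P Q)"

definition SP :: "nat \<Rightarrow> nat \<Rightarrow> nat" where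
  "SP n k = Max {card S | S. sperner_partition_system n k S}"

lemma finite_k_partitions: "finite (k_partitions n k)"
proof (rule finite_subset)
  show "k_partitions n k \<subseteq> Pow (Pow {1..n})"
    by (auto simp: k_partitions_def partition_on_def)
qed simp

text \<open>The maximum in the definition of \<^const>\<open>SP\<close> is taken over a finite nonempty set.\<close>

lemma finite_sperner_cards: "finite {card S | S. sperner_partition_system n k S}"
proof (rule finite_subset)
  show "{card S | S. sperner_partition_system n k S} \<subseteq> card ` Pow (k_partitions n k)"
    by (auto simp: sperner_partition_system_def)
qed (simp add: finite_k_partitions)

lemma sperner_cards_nonempty: "{card S | S. sperner_partition_system n k S} \<noteq> {}"
proof -
  have "sperner_partition_system n k {}"
    by (simp add: sperner_partition_system_def)
  then show ?thesis by blast
qed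

end

theory Submission
  imports Defs
begin

text \<open>
  Write \<open>f x = 1 / (n choose x)\<close>.  Distinct classes of one partition are disjoint and non-empty, and
  two classes of different members of a Sperner partition system are incomparable by definition.
  Hence the members of a system \<open>S\<close> are pairwise disjoint as sets of classes, and the set of all
  classes that occur is an antichain of subsets of \<open>{1..n}\<close>.  The LYM inequality
  (\<open>antichain_LYM_inequality\<close>) bounds the sum of \<open>f |A|\<close> over all these classes by 1.

  Conversely, the \<open>k\<close> class sizes of one partition add up to \<open>n = c k + r\<close>.  Since \<open>f\<close> is convex on
  \<open>{0..n}\<close> (\<open>inverse_binomial_convex\<close>), a partition contributes least to that sum when its class
  sizes are as equal as possible, that is, \<open>k - r\<close> classes of size \<open>c\<close> and \<open>r\<close> classes of size
  \<open>c + 1\<close>.  So every partition contributes at least \<open>D = (k - r) f(c) + r f(c + 1)\<close>, and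
  \<open>|S| D \<le> 1\<close>.  The claimed bound is \<open>1 / D\<close>, because
  \<open>(n choose c) / (n choose (c + 1)) = (c + 1) / (n - c)\<close> whenever \<open>c < n\<close>, in particular if \<open>r > 0\<close>.
\<close>

section \<open>The LYM inequality\<close>

text \<open>
  The proof is by induction on the ground set \<open>X\<close>, which is easier than counting maximal chains.
  If \<open>A \<noteq> X\<close> has size \<open>a\<close> and \<open>|X| = n\<close>, then
  \<open>1 / (n choose a) = (n - a) / (n * ((n - 1) choose a))\<close>: the weight of \<open>A\<close> in \<open>X\<close> is \<open>1 / n\<close> times
  the sum of its weights in the \<open>n - a\<close> sets \<open>X - {x}\<close> that contain it.  For each \<open>x\<close>, the members of
  the antichain that avoid \<open>x\<close> form an antichain in \<open>X - {x}\<close>, of total weight at most 1.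
\<close>

lemma antichain_LYM_inequality:
  assumes "finite X" and "F \<subseteq> Pow X"
    and "\<And>A B. A \<in> F \<Longrightarrow> B \<in> F \<Longrightarrow> A \<subseteq> B \<Longrightarrow> A = B"
  shows "(\<Sum>A\<in>F. 1 / real (card X choose card A)) \<le> 1"
  using assms
proof (induction "card X" arbitrary: X F)
  case 0
  then have "X = {}" by simp
  with 0 have "F = {} \<or> F = {{}}" by (simp add: subset_singleton_iff)
  with \<open>X = {}\<close> show ?case by auto
next
  case (Suc m)
  have finF: "finite F" using Suc.prems(1,2) by (simp add: finite_subset)
  show ?case
  proof (cases "X \<in> F")
    case True
    with Suc.prems have "F = {X}" by blast
    then show ?thesis by simp
  next
    case False
    have weight: "1 / real (card X choose card A) =
        (1 / real (card X)) * (\<Sum>x\<in>X. if x \<notin> A then 1 / real (m choose card A) else 0)"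
      if A: "A \<in> F" for A
    proof -
      have AX: "A \<subseteq> X" "A \<noteq> X" using A Suc.prems False by auto
      then have less: "card A < card X" using Suc.prems psubset_card_mono by blast
      have "{x\<in>X. x \<notin> A} = X - A" by blast
      then have "(\<Sum>x\<in>X. if x \<notin> A then 1 / real (m choose card A) else 0)
          = real (card X - card A) / real (m choose card A)"
        using Suc.prems AX
        by (simp add: sum.inter_filter[symmetric] card_Diff_subset finite_subset)
      moreover have "real (card X - card A) * real (card X choose card A)
          = real (card X) * real (m choose card A)"
        using binomial_absorb_comp[of "card X" "card A"] Suc.hyps(2)
        by (metis diff_Suc_1 of_nat_mult)
      moreover have "real (m choose card A) > 0" "real (card X choose card A) > 0" "real (card X) > 0"
        using less Suc.hyps(2) by simp_all
      ultimately show ?thesis by (simp add: frac_eq_eq)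
    qed
    have avoid: "(\<Sum>A\<in>F. if x \<notin> A then 1 / real (m choose card A) else 0) \<le> 1" if x: "x \<in> X" for x
    proof -
      have c: "card (X - {x}) = m" using x Suc.hyps(2) Suc.prems(1) by simp
      have "(\<Sum>A\<in>{A\<in>F. x \<notin> A}. 1 / real (card (X - {x}) choose card A)) \<le> 1"
      proof (rule Suc.hyps(1))
        show "{A\<in>F. x \<notin> A} \<subseteq> Pow (X - {x})" using Suc.prems(2) by auto
      qed (use c Suc.prems in auto)
      with finF c show ?thesis by (simp add: sum.inter_filter)
    qed
    have "(\<Sum>A\<in>F. 1 / real (card X choose card A)) =
        (1 / real (card X)) * (\<Sum>A\<in>F. \<Sum>x\<in>X. if x \<notin> A then 1 / real (m choose card A) else 0)"
      using weight by (simp add: sum_distrib_left)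
    also have "\<dots> =
        (1 / real (card X)) * (\<Sum>x\<in>X. \<Sum>A\<in>F. if x \<notin> A then 1 / real (m choose card A) else 0)"
      by (subst sum.swap) simp
    also have "\<dots> \<le> (1 / real (card X)) * (\<Sum>x\<in>X. 1)"
      by (intro mult_left_mono sum_mono avoid) auto
    also have "\<dots> = 1" using Suc.hyps(2) by simp
    finally show ?thesis .
  qed
qed

section \<open>Convexity\<close>

lemma binomial_Suc_times:
  "real (Suc x) * real (n choose Suc x) = real (n - x) * real (n choose x)"
  by (metis binomial_absorb_comp binomial_absorption of_nat_mult)

text \<open>
  With \<open>p = x + 1\<close> and \<open>q = n - x - 1\<close>, multiplication by \<open>n choose p\<close> turns the claim into
  \<open>(q + 1) / p + (p + 1) / q \<ge> 2\<close>, which follows from \<open>q / p + p / q \<ge> 2\<close>.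
\<close>

lemma inverse_binomial_convex:
  assumes "Suc x < n"
  shows "2 * (1 / real (n choose Suc x)) \<le> 1 / real (n choose x) + 1 / real (n choose Suc (Suc x))"
proof -
  define p q where "p = real (Suc x)" and "q = real n - real (Suc x)"
  have pq: "p > 0" "q > 0" using assms by (auto simp: p_def q_def)
  define b0 b1 b2 where "b0 = real (n choose x)" and "b1 = real (n choose Suc x)"
    and "b2 = real (n choose Suc (Suc x))"
  have b: "b0 > 0" "b1 > 0" "b2 > 0"
    using assms by (auto simp: b0_def b1_def b2_def)
  have "p * b1 = (q + 1) * b0"
    using binomial_Suc_times[of x n] assms by (simp add: p_def q_def b0_def b1_def)
  moreover have "1 / b0 = (q + 1) / ((q + 1) * b0)" using pq by simp
  ultimately have f0: "1 / b0 = (q + 1) / p * (1 / b1)" by simp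
  have "(p + 1) * b2 = q * b1"
    using binomial_Suc_times[of "Suc x" n] assms
    by (simp add: p_def q_def b2_def b1_def algebra_simps)
  then have f2: "1 / b2 = (p + 1) / q * (1 / b1)" using b pq by (simp add: field_simps)
  have "2 * (p * q) \<le> (q + 1) * q + (p + 1) * p"
    using sum_squares_bound[of p q] pq by (simp add: power2_eq_square algebra_simps)
  then have "2 \<le> (q + 1) / p + (p + 1) / q" using pq by (simp add: field_simps)
  then have "2 * (1 / b1) \<le> ((q + 1) / p + (p + 1) / q) * (1 / b1)"
    using b by (intro mult_right_mono) auto
  also have "\<dots> = 1 / b0 + 1 / b2" unfolding f0 f2 by (rule distrib_right)
  finally show ?thesis unfolding b0_def b1_def b2_def .
qed

lemma convex_sequence_above_secant:
  fixes f :: "nat \<Rightarrow> real"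
  assumes conv: "\<And>x. Suc x < n \<Longrightarrow> 2 * f (Suc x) \<le> f x + f (Suc (Suc x))"
    and m: "m < n" and x: "x \<le> n"
  shows "f m + (real x - real m) * (f (Suc m) - f m) \<le> f x"
proof -
  have diff_mono: "f (Suc i) - f i \<le> f (Suc j) - f j" if "i \<le> j" "j < n" for i j
    using that
  proof (induction rule: dec_induct)
    case (step j)
    then show ?case using conv[of j] by simp
  qed simp
  show ?thesis
  proof (cases "m \<le> x")
    case True
    then show ?thesis using x
    proof (induction rule: dec_induct)
      case (step j)
      then show ?case using diff_mono[of m j] by (simp add: algebra_simps)
    qed simp
  next
    case False
    then have "x \<le> m" by simp
    then show ?thesis
    proof (induction rule: inc_induct)
      case (step j)
      then show ?case using diff_mono[of j m] m by (simp add: algebra_simps)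
    qed simp
  qed
qed

text \<open>
  Equal distribution is optimal: sum the secant bound through \<open>m\<close> and \<open>m + 1\<close> over all values, whose
  total is prescribed.  Allowing \<open>t = card P\<close> makes the statement usable with \<open>m + 1\<close> in the role of
  the common value even if \<open>m + 1\<close> is the right end of the range of convexity.
\<close>

lemma convex_sum_ge_balanced:
  fixes f :: "nat \<Rightarrow> real" and g :: "'a \<Rightarrow> nat"
  assumes conv: "\<And>x. Suc x < n \<Longrightarrow> 2 * f (Suc x) \<le> f x + f (Suc (Suc x))"
    and m: "m < n" and g: "\<And>a. a \<in> P \<Longrightarrow> g a \<le> n"
    and total: "(\<Sum>a\<in>P. g a) = m * card P + t"
  shows "(real (card P) - real t) * f m + real t * f (Suc m) \<le> (\<Sum>a\<in>P. f (g a))"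
proof -
  let ?d = "f (Suc m) - f m"
  have "(\<Sum>a\<in>P. f m + (real (g a) - real m) * ?d) =
      real (card P) * f m + (real (\<Sum>a\<in>P. g a) - real (card P) * real m) * ?d"
    by (simp add: sum.distrib sum_distrib_right[symmetric] sum_subtractf)
  also have "\<dots> = (real (card P) - real t) * f m + real t * f (Suc m)"
    unfolding total by (simp add: algebra_simps)
  finally show ?thesis
    using sum_mono[of P "\<lambda>a. f m + (real (g a) - real m) * ?d" "\<lambda>a. f (g a)"]
      convex_sequence_above_secant[of n f m, OF conv m g] by simp
qed

section \<open>The bound for Sperner partition systems\<close>

lemma partition_on_finite_class:
  assumes "partition_on X P" "finite X" "A \<in> P"
  shows "finite A" and "card A \<le> card X"
  using assms by (auto simp: partition_on_def intro: finite_subset card_mono)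

lemma k_partition_weight_ge:
  assumes P: "P \<in> k_partitions n k" and "c > 0" "k > 0" and n: "n = c * k + r" and "r < k"
  shows "(real k - real r) * (1 / real (n choose c)) + real r * (1 / real (n choose Suc c))
     \<le> (\<Sum>A\<in>P. 1 / real (n choose card A))"
proof -
  have part: "partition_on {1..n} P" and k: "card P = k" using P by (auto simp: k_partitions_def)
  have "card (\<Union>P) = (\<Sum>A\<in>P. card A)"
    using part partition_on_finite_class(1)[OF part]
    by (intro card_Union_disjoint) (auto simp: partition_on_def)
  then have total: "(\<Sum>A\<in>P. card A) = n" using part by (simp add: partition_on_def)
  have le: "card A \<le> n" if "A \<in> P" for A
    using partition_on_finite_class(2)[OF part _ that] by simp
  have balanced: "(real (card P) - real t) * (1 / real (n choose m))
      + real t * (1 / real (n choose Suc m)) \<le> (\<Sum>A\<in>P. 1 / real (n choose card A))"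
    if "m < n" "(\<Sum>A\<in>P. card A) = m * card P + t" for m t
    using that le inverse_binomial_convex
    by (intro convex_sum_ge_balanced[where f = "\<lambda>x. 1 / real (n choose x)" and g = card]) auto
  have ck: "c \<le> c * k" using \<open>k > 0\<close> by simp
  show ?thesis
  proof (cases "r = 0")
    case True
    \<comment> \<open>For \<open>k = 1\<close> the size \<open>c\<close> equals \<open>n\<close>, so the secant must end at \<open>c\<close> instead of starting there.\<close>
    have "c - 1 < n" using ck n \<open>c > 0\<close> by linarith
    moreover have "(\<Sum>A\<in>P. card A) = (c - 1) * card P + k"
      using \<open>c > 0\<close> True n total k by (cases c) auto
    ultimately show ?thesis
      using balanced[of "c - 1" k] True \<open>c > 0\<close> k by simp
  next
    case False
    then have "c < n" using ck n by linarith
    moreover have "(\<Sum>A\<in>P. card A) = c * card P + r" using n total k by simp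
    ultimately show ?thesis using balanced[of c r] k by simp
  qed
qed

lemma sperner_partition_system_LYM:
  assumes S: "sperner_partition_system n k S"
  shows "(\<Sum>P\<in>S. \<Sum>A\<in>P. 1 / real (n choose card A)) \<le> 1"
proof -
  have part: "partition_on {1..n} P" if "P \<in> S" for P
    using S that by (auto simp: sperner_partition_system_def k_partitions_def)
  have incomparable: "\<not> A \<subseteq> B" if "P \<in> S" "Q \<in> S" "P \<noteq> Q" "A \<in> P" "B \<in> Q" for P Q A B
    using S that unfolding sperner_partition_system_def sperner_property_def by blast
  have sub: "\<Union>S \<subseteq> Pow {1..n}" using part by (auto simp: partition_on_def)
  have antichain: "A = B" if "A \<in> \<Union>S" "B \<in> \<Union>S" "A \<subseteq> B" for A B
  proof -
    obtain P Q where PQ: "P \<in> S" "A \<in> P" "Q \<in> S" "B \<in> Q" using \<open>A \<in> \<Union>S\<close> \<open>B \<in> \<Union>S\<close> by blast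
    then have "P = Q" using incomparable \<open>A \<subseteq> B\<close> by blast
    then have "A \<noteq> {}" "A \<noteq> B \<Longrightarrow> A \<inter> B = {}"
      using part[OF PQ(1)] PQ by (auto simp: partition_on_def disjoint_def)
    with \<open>A \<subseteq> B\<close> show ?thesis by blast
  qed
  have "\<forall>P\<in>S. finite P" using part finite_elements by blast
  moreover have "\<forall>P\<in>S. \<forall>Q\<in>S. P \<noteq> Q \<longrightarrow> P \<inter> Q = {}" using incomparable by blast
  ultimately have "(\<Sum>P\<in>S. \<Sum>A\<in>P. 1 / real (n choose card A)) =
      (\<Sum>A\<in>\<Union>S. 1 / real (n choose card A))"
    by (simp add: sum.Union_disjoint)
  also have "\<dots> \<le> 1"
    using antichain_LYM_inequality[of "{1..n}" "\<Union>S"] sub antichain by simp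
  finally show ?thesis .
qed

theorem theorem7p1p6:
  fixes n k c r :: nat
  assumes "n > 0" and "k > 0" and "c > 0"
    and "n = c * k + r" and "r < k"
  shows "real (SP n k) \<le>
    real (n choose c) /
      ((real k - real r) +
        (if r = 0 then 0 else real r * (real c + 1) / (real n - real c)))"
proof -
  obtain S where S: "sperner_partition_system n k S" and SP: "SP n k = card S"
    using Max_in[OF finite_sperner_cards sperner_cards_nonempty, of n k] by (auto simp: SP_def)
  define b where "b = real (n choose c)"
  define D where "D = (real k - real r) * (1 / b) + real r * (1 / real (n choose Suc c))"
  define E where "E = (real k - real r) +
      (if r = 0 then 0 else real r * (real c + 1) / (real n - real c))"
  have ck: "c \<le> c * k" using \<open>k > 0\<close> by simp
  then have cn: "c \<le> n" using assms by linarith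
  then have b: "b > 0" by (simp add: b_def)
  have "D = E / b"
  proof (cases "r = 0")
    case True
    then show ?thesis by (simp add: D_def E_def)
  next
    case False
    then have less: "c < n" using ck assms by linarith
    then have pos: "real (n choose Suc c) > 0" by simp
    have "(real c + 1) * real (n choose Suc c) = (real n - real c) * b"
      using binomial_Suc_times[of c n] less by (simp add: b_def algebra_simps)
    then have "1 / real (n choose Suc c) = (real c + 1) / (real n - real c) / b"
      using pos b less by (simp add: field_simps)
    then have "D = (real k - real r) / b + real r * ((real c + 1) / (real n - real c) / b)"
      unfolding D_def by simp
    then show ?thesis using False by (simp add: E_def add_divide_distrib[of "real k - real r"])
  qed
  moreover have "E > 0"
    using \<open>r < k\<close> cn by (auto simp: E_def intro!: add_pos_nonneg)
  moreover have "real (card S) * D \<le> 1"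
  proof -
    have "real (card S) * D = (\<Sum>P\<in>S. D)" by simp
    also have "\<dots> \<le> (\<Sum>P\<in>S. \<Sum>A\<in>P. 1 / real (n choose card A))"
      unfolding D_def b_def using S assms
      by (intro sum_mono k_partition_weight_ge) (auto simp: sperner_partition_system_def)
    also have "\<dots> \<le> 1" using S by (rule sperner_partition_system_LYM)
    finally show ?thesis .
  qed
  ultimately have "real (card S) \<le> b / E"
    using b by (simp add: pos_le_divide_eq pos_divide_le_eq)
  then show ?thesis by (simp add: SP E_def b_def)
qed

end
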